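(* Let $(\gamma_n)_n$ be a sequence of strictly positive real numbers with $\gamma_n \to +\infty$ as $n\to+\infty$, and let $\Phi:\mathbb{R}\to\mathbb{C}$ be a continuous function satisfying $\Phi(0)=1$ and $\overline{\Phi(u)} = \Phi(-u)$ for all $u\in\mathbb{R}$. Suppose moreover that: (1) $\Phi$ can be analytically extended to the whole complex plane (the extension being still denoted $\Phi$) and, for every $\beta \in \mathbb{R}$, $\sup_{z \in a + i[0,\beta]} |\Phi(z)| < \infty$ for all $a\in\mathbb{R}$, and $\sup_{z \in a + i[0,\beta]} |\Phi(z)| \to 0$ as $a \to \pm\infty$; (2) $\Phi(ix) = \Phi(x)$ for all $x\in\mathbb{R}$; (3) $\Phi(x) \geq 0$ for all $x\in\mathbb{R}$. Let $G\sim\mathcal{N}(0,1)$ and define the distribution of a random variable $\mathcal{H}_{\gamma_n}(\Phi)$ by $$\mathbb{E}\big( f(\mathcal{H}_{\gamma_n}(\Phi)) \big) = \frac{\mathbb{E}\big( f(\gamma_n G)\,\Phi(G/\gamma_n) \big)}{\mathbb{E}\big( \Phi(G/\gamma_n) \big)}$$ for all bounded measurable $f:\mathbb{R}\to\mathbb{R}$. Then, as $n\to\infty$, $\mathcal{H}_{\gamma_n}(\Phi)/\gamma_n$ converges in law to $\mathcal{N}(0,1)$, and $(\mathcal{H}_{\gamma_n}(\Phi))_n$ converges in the mod-Gaussian sense at speed $(\gamma_n)_n$ to $\Phi$.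
   Context: A sequence $(X_n)_n$ of real random variables of expectation $0$ is said to converge in the mod-Gaussian sense at speed $(\gamma_n)_n$ (strictly positive reals) to a function $\Phi:\mathbb{R}\to\mathbb{C}$ if, with $G\sim\mathcal{N}(0,1)$, $$\frac{\mathbb{E}(e^{iuX_n})}{\mathbb{E}(e^{iu\gamma_n G})} \longrightarrow \Phi(u) \qquad (n\to+\infty)$$ locally uniformly in $u\in\mathbb{R}$. The notation $a + i[0,\beta]$ denotes the vertical segment $\{a+iy : y \text{ between } 0 \text{ and } \beta\}$. *)

theory Defs
  imports "HOL-Probability.Probability" "HOL-Complex_Analysis.Complex_Analysis"
begin

text \<open>The expectation of \<open>g G\<close> for \<open>G\<close> standard Gaussian is written as the
  integral of \<open>g\<close> against \<^term>\<open>std_normal_distribution\<close>.\<close>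

definition mod_gaussian_converges ::
    "(nat \<Rightarrow> 'a measure) \<Rightarrow> (nat \<Rightarrow> 'a \<Rightarrow> real) \<Rightarrow> (nat \<Rightarrow> real) \<Rightarrow> (real \<Rightarrow> complex) \<Rightarrow> bool" where
  "mod_gaussian_converges M X \<gamma> \<Phi> \<longleftrightarrow>
     (\<forall>n. prob_space (M n) \<and> integrable (M n) (X n) \<and> (\<integral>\<omega>. X n \<omega> \<partial>M n) = 0) \<and>
     (\<forall>n. 0 < \<gamma> n) \<and>
     (\<forall>u\<^sub>0. \<exists>U. open U \<and> u\<^sub>0 \<in> U \<and>
        uniform_limit U
          (\<lambda>n u. (\<integral>\<omega>. iexp (u * X n \<omega>) \<partial>M n) /
                 (\<integral>x. iexp (u * \<gamma> n * x) \<partial>std_normal_distribution))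
          \<Phi> sequentially)"

text \<open>The vertical segment \<open>a + i[0,\<beta>]\<close>; \<open>\<beta>\<close> may be negative, and
  \<open>closed_segment 0 \<beta>\<close> is the set of reals between \<open>0\<close> and \<open>\<beta>\<close>.\<close>

definition vertical_segment :: "real \<Rightarrow> real \<Rightarrow> complex set" where
  "vertical_segment a \<beta> = (\<lambda>y. Complex a y) ` closed_segment 0 \<beta>"

text \<open>The real random variable \<open>X\<close> on \<open>M\<close> has the law of \<open>\<H>\<^sub>\<gamma>(\<Phi>)\<close>. The
  left-hand side is embedded into the complex numbers since \<open>\<Phi>\<close> is complex-valued.\<close>

definition has_tilted_gaussian_law ::
    "'a measure \<Rightarrow> ('a \<Rightarrow> real) \<Rightarrow> real \<Rightarrow> (real \<Rightarrow> complex) \<Rightarrow> bool" where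
  "has_tilted_gaussian_law M X \<gamma> \<Phi> \<longleftrightarrow>
     prob_space M \<and> X \<in> borel_measurable M \<and>
     (\<forall>f :: real \<Rightarrow> real. f \<in> borel_measurable borel \<longrightarrow> bounded (range f) \<longrightarrow>
        complex_of_real (\<integral>\<omega>. f (X \<omega>) \<partial>M) =
          (\<integral>x. complex_of_real (f (\<gamma> * x)) * \<Phi> (x / \<gamma>) \<partial>std_normal_distribution) /
          (\<integral>x. \<Phi> (x / \<gamma>) \<partial>std_normal_distribution))"

lemma integral_tilt_pos:
  fixes g :: "real \<Rightarrow> real"
  assumes "continuous_on UNIV g" "bounded (range g)" "\<And>x. 0 \<le> g x" "g 0 = 1"
  shows "0 < (\<integral>x. g x \<partial>std_normal_distribution)"
proof -
  interpret N: prob_space std_normal_distribution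
    by (rule prob_space_normal_density) simp
  have [measurable]: "g \<in> borel_measurable borel"
    using assms(1) by (rule borel_measurable_continuous_onI)
  obtain B where B: "\<And>x. norm (g x) \<le> B"
    using assms(2) by (auto simp: bounded_iff)
  have int: "integrable std_normal_distribution g"
    by (rule N.integrable_const_bound[of _ B]) (use B in simp_all)
  have "(\<integral>x. g x \<partial>std_normal_distribution) \<noteq> 0"
  proof
    assume "(\<integral>x. g x \<partial>std_normal_distribution) = 0"
    then have "AE x in std_normal_distribution. g x = 0"
      using integral_nonneg_eq_0_iff_AE[OF int] assms(3) by auto
    then have ae: "AE x in lborel. g x = 0"
      by (subst (asm) AE_density) (auto simp: normal_density_pos)
    obtain d where d: "d > 0" "\<And>x. dist x 0 < d \<Longrightarrow> dist (g x) (g 0) < 1"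
      using assms(1) unfolding continuous_on_iff by (metis UNIV_I zero_less_one)
    have "AE x in lborel. x \<notin> {-d/2..d/2}"
      using ae
    proof eventually_elim
      case (elim x)
      show ?case
      proof
        assume "x \<in> {-d/2..d/2}"
        then have "\<bar>x\<bar> < d" using d(1) by auto
        then show False using d(2)[of x] elim assms(4) by (simp add: dist_real_def)
      qed
    qed
    then have "emeasure lborel {-d/2..d/2} = 0"
      by (subst (asm) AE_iff_measurable[of "{-d/2..d/2}"]) auto
    then show False using d(1) by simp
  qed
  moreover have "0 \<le> (\<integral>x. g x \<partial>std_normal_distribution)"
    using assms(3) by (intro Bochner_Integration.integral_nonneg) auto
  ultimately show ?thesis by linarith
qed

text \<open>The law of \<open>\<H>\<^sub>\<gamma>(\<Phi>)\<close> exists and is unique.\<close>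

lemma tilted_gaussian_law_ex1:
  fixes \<Phi> :: "real \<Rightarrow> complex"
  assumes "0 < \<gamma>" "continuous_on UNIV \<Phi>" "bounded (range \<Phi>)"
    and nn: "\<And>x. \<Phi> x \<in> \<real>\<^sub>\<ge>\<^sub>0" and "\<Phi> 0 = 1"
  shows "\<exists>!\<mu>. sets \<mu> = sets borel \<and> has_tilted_gaussian_law \<mu> (\<lambda>x. x) \<gamma> \<Phi>"
proof (rule ex_ex1I)
  define g where "g x = Re (\<Phi> (x / \<gamma>))" for x
  have \<Phi>g: "\<Phi> (x / \<gamma>) = complex_of_real (g x)" for x
    using nn[of "x / \<gamma>"] by (auto simp: g_def complex_nonneg_Reals_iff complex_eq_iff)
  have g0: "0 \<le> g x" for x
    using nn[of "x / \<gamma>"] by (auto simp: g_def complex_nonneg_Reals_iff)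
  have gcont: "continuous_on UNIV g"
    unfolding g_def
    by (intro continuous_intros continuous_on_compose2[OF assms(2)]) (use assms(1) in auto)
  obtain B where B: "\<And>x. norm (\<Phi> x) \<le> B"
    using assms(3) by (auto simp: bounded_iff)
  have gB: "\<bar>g x\<bar> \<le> B" for x
    using B[of "x / \<gamma>"] abs_Re_le_cmod[of "\<Phi> (x / \<gamma>)"] by (simp add: g_def)
  have [measurable]: "g \<in> borel_measurable borel"
    using gcont by (rule borel_measurable_continuous_onI)
  define c where "c = (\<integral>x. g x \<partial>std_normal_distribution)"
  have c: "0 < c"
  proof -
    have "bounded (range g)"
      unfolding bounded_iff by (rule exI[of _ B]) (simp add: gB)
    moreover have "g 0 = 1" by (simp add: g_def assms(5))
    ultimately show ?thesis unfolding c_def by (intro integral_tilt_pos gcont g0)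
  qed
  interpret N: prob_space std_normal_distribution
    by (rule prob_space_normal_density) simp
  have gint: "integrable std_normal_distribution g"
    by (rule N.integrable_const_bound[of _ B]) (use gB in simp_all)
  define D where "D = density std_normal_distribution (\<lambda>x. ennreal (g x / c))"
  have "emeasure D (space D) = (\<integral>\<^sup>+x. ennreal (g x / c) \<partial>std_normal_distribution)"
    unfolding D_def by (subst emeasure_density) auto
  also have "\<dots> = ennreal (\<integral>x. g x / c \<partial>std_normal_distribution)"
    using gint g0 c by (intro nn_integral_eq_integral) auto
  also have "(\<integral>x. g x / c \<partial>std_normal_distribution) = 1"
    using c by (simp add: c_def)
  finally interpret D: prob_space D by (intro prob_spaceI) simp
  have Dm [measurable_cong]: "sets D = sets borel" by (simp add: D_def)
  define \<mu> where "\<mu> = distr D borel (\<lambda>x. \<gamma> * x)"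
  have pm: "prob_space \<mu>" unfolding \<mu>_def by (rule D.prob_space_distr) measurable
  have "complex_of_real (\<integral>x. f x \<partial>\<mu>) =
          (\<integral>x. complex_of_real (f (\<gamma> * x)) * \<Phi> (x / \<gamma>) \<partial>std_normal_distribution) /
          (\<integral>x. \<Phi> (x / \<gamma>) \<partial>std_normal_distribution)"
    if [measurable]: "f \<in> borel_measurable borel" for f :: "real \<Rightarrow> real"
  proof -
    have "(\<integral>x. f x \<partial>\<mu>) = (\<integral>x. f (\<gamma> * x) \<partial>D)"
      unfolding \<mu>_def by (rule integral_distr) measurable
    also have "\<dots> = (\<integral>x. (g x / c) *\<^sub>R f (\<gamma> * x) \<partial>std_normal_distribution)"
      unfolding D_def using g0 c by (intro integral_density) auto
    also have "\<dots> = (\<integral>x. (f (\<gamma> * x) * g x) / c \<partial>std_normal_distribution)"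
      by (simp add: mult_ac)
    also have "\<dots> = (\<integral>x. f (\<gamma> * x) * g x \<partial>std_normal_distribution) / c"
      by (rule integral_divide_zero)
    finally show ?thesis
      by (simp add: \<Phi>g c_def flip: of_real_mult)
  qed
  then have "has_tilted_gaussian_law \<mu> (\<lambda>x. x) \<gamma> \<Phi>"
    using pm by (auto simp: has_tilted_gaussian_law_def \<mu>_def)
  then show "\<exists>\<mu>. sets \<mu> = sets borel \<and> has_tilted_gaussian_law \<mu> (\<lambda>x. x) \<gamma> \<Phi>"
    by (intro exI[of _ \<mu>]) (simp add: \<mu>_def)
next
  fix \<mu> \<nu> :: "real measure"
  assume \<mu>: "sets \<mu> = sets borel \<and> has_tilted_gaussian_law \<mu> (\<lambda>x. x) \<gamma> \<Phi>"
    and \<nu>: "sets \<nu> = sets borel \<and> has_tilted_gaussian_law \<nu> (\<lambda>x. x) \<gamma> \<Phi>"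
  interpret M: prob_space \<mu> using \<mu> by (simp add: has_tilted_gaussian_law_def)
  interpret N: prob_space \<nu> using \<nu> by (simp add: has_tilted_gaussian_law_def)
  show "\<mu> = \<nu>"
  proof (rule measure_eqI)
    show "sets \<mu> = sets \<nu>" using \<mu> \<nu> by simp
  next
    fix A assume A: "A \<in> sets \<mu>"
    let ?f = "indicator A :: real \<Rightarrow> real"
    have "?f \<in> borel_measurable borel" using A \<mu> by simp
    moreover have "bounded (range ?f)"
      by (auto simp: bounded_iff indicator_def)
    ultimately have "complex_of_real (\<integral>x. ?f x \<partial>\<mu>) = complex_of_real (\<integral>x. ?f x \<partial>\<nu>)"
      using \<mu>[THEN conjunct2] \<nu>[THEN conjunct2] unfolding has_tilted_gaussian_law_def
      by (elim conjE) (simp only: simp_thms)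
    then have "(\<integral>x. ?f x \<partial>\<mu>) = (\<integral>x. ?f x \<partial>\<nu>)" by (simp only: of_real_eq_iff)
    then have "measure \<mu> A = measure \<nu> A"
      using A \<mu> \<nu> sets.sets_into_space by (simp add: Int_absorb2)
    then show "emeasure \<mu> A = emeasure \<nu> A"
      by (simp add: M.emeasure_eq_measure N.emeasure_eq_measure)
  qed
qed

end

theory Submission
  imports Defs
begin

text \<open>The characteristic function of \<open>\<H>\<^sub>\<gamma>(\<Phi>)\<close> at \<open>u\<close> is a Gaussian integral of
  \<open>\<Phi>(x / \<gamma>)\<close> against \<open>exp (\<i>u\<gamma>x)\<close>. Moving the line of integration to imaginary part
  \<open>u\<gamma>\<close> extracts the factor \<open>exp (- (u\<gamma>)\<^sup>2 / 2)\<close> and leaves the mean of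
  \<open>\<Phi>(G / \<gamma> + \<i>u)\<close>. As \<open>\<Phi>\<close> is bounded on horizontal strips, Cauchy's estimate makes it
  Lipschitz there, so this mean differs from \<open>\<Phi>(\<i>u) = \<Phi>(u)\<close> by \<open>O(1/\<gamma>)\<close>, locally
  uniformly in \<open>u\<close>. The normalising constant is the case \<open>u = 0\<close>, and the central limit
  statement follows from the same estimate on the real line by Levy's theorem.\<close>

section \<open>Bounds and Lipschitz estimates on horizontal strips\<close>

text \<open>Decay at both ends controls the parts of the strip with large real part, and a compact
  rectangle remains, where continuity suffices. A vertical segment starts on the real axis, so the
  upper and lower halves of the strip are treated separately, with \<beta> equal to \<open>K\<close>
  and to \<open>- K\<close>.\<close>

lemma strip_bounded:
  fixes F :: "complex \<Rightarrow> complex"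
  assumes F: "continuous_on UNIV F"
    and bdd: "\<And>\<beta> a. bdd_above ((\<lambda>z. cmod (F z)) ` vertical_segment a \<beta>)"
    and top: "\<And>\<beta>. ((\<lambda>a. SUP z\<in>vertical_segment a \<beta>. cmod (F z)) \<longlongrightarrow> 0) at_top"
    and bot: "\<And>\<beta>. ((\<lambda>a. SUP z\<in>vertical_segment a \<beta>. cmod (F z)) \<longlongrightarrow> 0) at_bot"
  obtains B where "B > 0" "\<And>z. \<bar>Im z\<bar> \<le> K \<Longrightarrow> cmod (F z) \<le> B"
proof -
  have half: "\<exists>B. \<forall>z. Im z \<in> closed_segment 0 \<beta> \<longrightarrow> cmod (F z) \<le> B" for \<beta>
  proof -
    have "eventually (\<lambda>a. (SUP z\<in>vertical_segment a \<beta>. cmod (F z)) < 1) at_top"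
      using top[of \<beta>] by (rule order_tendstoD) simp
    then obtain r where r: "\<And>a. a \<ge> r \<Longrightarrow> (SUP z\<in>vertical_segment a \<beta>. cmod (F z)) < 1"
      by (auto simp: eventually_at_top_linorder)
    have "eventually (\<lambda>a. (SUP z\<in>vertical_segment a \<beta>. cmod (F z)) < 1) at_bot"
      using bot[of \<beta>] by (rule order_tendstoD) simp
    then obtain l where l: "\<And>a. a \<le> l \<Longrightarrow> (SUP z\<in>vertical_segment a \<beta>. cmod (F z)) < 1"
      by (auto simp: eventually_at_bot_linorder)
    have "compact (F ` cbox (Complex l (- \<bar>\<beta>\<bar>)) (Complex r \<bar>\<beta>\<bar>))"
      by (intro compact_continuous_image compact_cbox continuous_on_subset[OF F]) auto
    then obtain B where B: "\<And>z. z \<in> cbox (Complex l (- \<bar>\<beta>\<bar>)) (Complex r \<bar>\<beta>\<bar>) \<Longrightarrow> cmod (F z) \<le> B"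
      by (meson compact_imp_bounded bounded_iff imageI)
    \<comment> \<open>The value 1 bounds the two tails and \<open>B\<close> the rectangle.\<close>
    have "cmod (F z) \<le> max 1 B" if z: "Im z \<in> closed_segment 0 \<beta>" for z
    proof (cases "l \<le> Re z \<and> Re z \<le> r")
      case True
      have "\<bar>Im z\<bar> \<le> \<bar>\<beta>\<bar>"
        using z by (auto simp: closed_segment_eq_real_ivl split: if_splits)
      then have "z \<in> cbox (Complex l (- \<bar>\<beta>\<bar>)) (Complex r \<bar>\<beta>\<bar>)"
        using True by (auto simp: in_cbox_complex_iff)
      from B[OF this] show ?thesis by simp
    next
      case False
      have "z \<in> vertical_segment (Re z) \<beta>"
        unfolding vertical_segment_def using z by (intro image_eqI[of _ _ "Im z"]) simp_all
      then have "cmod (F z) \<le> (SUP z\<in>vertical_segment (Re z) \<beta>. cmod (F z))"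
        by (intro cSUP_upper bdd)
      also have "\<dots> \<le> 1" using False l[of "Re z"] r[of "Re z"] by force
      finally show ?thesis by simp
    qed
    then show ?thesis by blast
  qed
  obtain B1 B2 where B1: "\<And>z. Im z \<in> closed_segment 0 K \<Longrightarrow> cmod (F z) \<le> B1"
    and B2: "\<And>z. Im z \<in> closed_segment 0 (- K) \<Longrightarrow> cmod (F z) \<le> B2"
    using half by meson
  show thesis
  \<comment> \<open>The outer maximum with 1 makes the bound strictly positive.\<close>
  proof (rule that[of "max 1 (max B1 B2)"])
    fix z assume "\<bar>Im z\<bar> \<le> K"
    then have "Im z \<in> closed_segment 0 K \<or> Im z \<in> closed_segment 0 (- K)"
      by (auto simp: closed_segment_eq_real_ivl)
    then show "cmod (F z) \<le> max 1 (max B1 B2)"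
      using B1[of z] B2[of z] by fastforce
  qed simp
qed

text \<open>The unit disc around a point of the strip of half-width \<open>K\<close> stays in the
  strip of half-width \<open>K + 1\<close>, so Cauchy's inequality with radius 1 bounds the
  derivative by the same \<open>B\<close>. The smaller strip is convex, and the mean value
  inequality applies.\<close>

lemma lipschitz_on_strip:
  fixes F :: "complex \<Rightarrow> complex"
  assumes F: "F holomorphic_on UNIV"
    and B: "\<And>z. \<bar>Im z\<bar> \<le> K + 1 \<Longrightarrow> cmod (F z) \<le> B"
    and z: "\<bar>Im z\<bar> \<le> K" and w: "\<bar>Im w\<bar> \<le> K"
  shows "cmod (F z - F w) \<le> B * cmod (z - w)"
proof (rule field_differentiable_bound)
  show "convex {z. \<bar>Im z\<bar> \<le> K}"
  proof -
    have "{z. \<bar>Im z\<bar> \<le> K} = {z. Im z \<le> K} \<inter> {z. Im z \<ge> - K}" by auto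
    then show ?thesis by (simp add: convex_Int convex_halfspace_Im_le convex_halfspace_Im_ge)
  qed
next
  fix x assume x: "x \<in> {z. \<bar>Im z\<bar> \<le> K}"
  show "(F has_field_derivative deriv F x) (at x within {z. \<bar>Im z\<bar> \<le> K})"
    using F by (intro holomorphic_derivI[of F UNIV]) auto
  have "cmod ((deriv ^^ 1) F x) \<le> fact 1 * B / 1 ^ 1"
  proof (rule Cauchy_inequality)
    show "F holomorphic_on ball x 1" "continuous_on (cball x 1) F"
      using F by (auto intro: holomorphic_on_subset holomorphic_on_imp_continuous_on)
    fix y assume "cmod (x - y) = 1"
    then have "\<bar>Im x - Im y\<bar> \<le> 1" using abs_Im_le_cmod[of "x - y"] by simp
    then show "cmod (F y) \<le> B" using x by (intro B) auto
  qed simp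
  then show "cmod (deriv F x) \<le> B" by simp
qed (use z w in auto)

section \<open>Shifting the line of integration\<close>

lemma integral_real_line_FTC:
  fixes f Q :: "real \<Rightarrow> complex"
  assumes Q: "\<And>x. (Q has_vector_derivative f x) (at x)"
    and f: "continuous_on UNIV f" "integrable lborel f"
    and "(Q \<longlongrightarrow> A) at_bot" "(Q \<longlongrightarrow> B) at_top"
  shows "(\<integral>x. f x \<partial>lborel) = B - A"
proof -
  have "(LBINT x=-\<infinity>..\<infinity>. f x) = B - A"
  proof (rule interval_integral_FTC_integrable[where F = Q])
    show "isCont f x" for x
      using f(1) by (simp add: continuous_on_eq_continuous_at)
    show "set_integrable lborel (einterval (-\<infinity>) \<infinity>) f"
      using f(2) by (simp add: set_integrable_def)
    show "((Q \<circ> real_of_ereal) \<longlongrightarrow> A) (at_right (-\<infinity>))"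
      using assms(4) by (simp add: ereal_tendsto_simps1)
    show "((Q \<circ> real_of_ereal) \<longlongrightarrow> B) (at_left \<infinity>)"
      using assms(5) by (simp add: ereal_tendsto_simps1)
  qed (use Q in auto)
  then show ?thesis by (simp add: interval_lebesgue_integral_def set_lebesgue_integral_def)
qed

text \<open>A global primitive \<open>P\<close> of \<open>k\<close> replaces rectangular contours.
  The increment \<open>Q\<close> of \<open>P\<close> across the vertical segment at \<open>x\<close>
  is an antiderivative of the difference of the two integrands, and it is at most
  \<open>b x * \<bar>t\<bar>\<close> in modulus, hence vanishes at both ends of the line.\<close>

lemma integral_horizontal_shift:
  fixes k :: "complex \<Rightarrow> complex"
  assumes k: "k holomorphic_on UNIV"
    and b: "\<And>z. Im z \<in> closed_segment 0 t \<Longrightarrow> cmod (k z) \<le> b (Re z)"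
    and lim: "(b \<longlongrightarrow> 0) at_top" "(b \<longlongrightarrow> 0) at_bot"
    and b_int: "integrable lborel b"
  shows "(\<integral>x. k (of_real x) \<partial>lborel) = (\<integral>x. k (Complex x t) \<partial>lborel)"
proof -
  obtain P where P: "\<And>z. (P has_field_derivative k z) (at z)"
    using holomorphic_convex_primitive'[OF _ _ k] by auto
  have kc: "continuous_on UNIV k" by (rule holomorphic_on_imp_continuous_on[OF k])
  have line: "continuous_on UNIV (\<lambda>x. k (Complex x s))" for s
    by (intro continuous_on_compose2[OF kc] continuous_intros) auto
  have int: "integrable lborel (\<lambda>x. k (Complex x s))" if "s \<in> closed_segment 0 t" for s
  proof (rule Bochner_Integration.integrable_bound[OF b_int])
    show "(\<lambda>x. k (Complex x s)) \<in> borel_measurable lborel"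
      using borel_measurable_continuous_onI[OF line] by simp
    show "AE x in lborel. norm (k (Complex x s)) \<le> norm (b x)"
    proof (rule AE_I2)
      fix x show "norm (k (Complex x s)) \<le> norm (b x)"
        using b[of "Complex x s"] that by simp
    qed
  qed
  define Q where "Q x = P (Complex x t) - P (Complex x 0)" for x
  have Qb: "cmod (Q x) \<le> b x * \<bar>t\<bar>" for x
  proof -
    have "cmod (P (Complex x t) - P (Complex x 0)) \<le> b x * cmod (Complex x t - Complex x 0)"
    proof (rule field_differentiable_bound)
      show "convex (closed_segment (Complex x 0) (Complex x t))" by simp
      fix z assume z: "z \<in> closed_segment (Complex x 0) (Complex x t)"
      show "(P has_field_derivative k z) (at z within closed_segment (Complex x 0) (Complex x t))"
        using P by (rule has_field_derivative_at_within)
      from z obtain u where u: "0 \<le> u" "u \<le> 1"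
        "z = (1 - u) *\<^sub>R Complex x 0 + u *\<^sub>R Complex x t"
        by (auto simp: in_segment)
      have "Re z = x" by (simp add: u(3) left_diff_distrib)
      moreover have "Im z \<in> closed_segment 0 t"
        using u(1,2) by (auto simp: in_segment u(3))
      ultimately show "cmod (k z) \<le> b x" using b[of z] by simp
    qed simp_all
    then show ?thesis by (simp add: Q_def complex_diff complex_norm)
  qed
  have Q0: "(Q \<longlongrightarrow> 0) F" if "(b \<longlongrightarrow> 0) F" for F
  proof (rule Lim_null_comparison)
    show "\<forall>\<^sub>F x in F. norm (Q x) \<le> b x * \<bar>t\<bar>" using Qb by simp
    show "((\<lambda>x. b x * \<bar>t\<bar>) \<longlongrightarrow> 0) F" using that by (rule tendsto_mult_left_zero)
  qed
  have "((\<lambda>x. P (Complex x s)) has_vector_derivative k (Complex x s)) (at x)" for x s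
  proof -
    \<comment> \<open>A horizontal line has velocity 1, so the derivative of \<open>P\<close> along
      it is \<open>k\<close> with no extra factor.\<close>
    have "((\<lambda>x. Complex x s) has_vector_derivative 1) (at x)"
      unfolding Complex_eq by (auto intro!: derivative_eq_intros)
    from field_vector_diff_chain_at[OF this P] show ?thesis by (simp add: o_def)
  qed
  then have "(Q has_vector_derivative (k (Complex x t) - k (Complex x 0))) (at x)" for x
    unfolding Q_def by (intro has_vector_derivative_diff)
  then have "(\<integral>x. k (Complex x t) - k (Complex x 0) \<partial>lborel) = 0 - 0"
    by (intro integral_real_line_FTC continuous_intros line
          Bochner_Integration.integrable_diff int) (use Q0[OF lim(1)] Q0[OF lim(2)] in auto)
  then show ?thesis
    by (simp add: Bochner_Integration.integral_diff int complex_of_real_def)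
qed

text \<open>Completing the square turns the left-hand side into an integral of
  \<open>exp (- (z - \<i>t)\<^sup>2 / 2) F z\<close> over the real line, which is then moved to the line of
  imaginary part \<open>t\<close>.\<close>

lemma gaussian_contour_shift:
  fixes F :: "complex \<Rightarrow> complex"
  assumes F: "F holomorphic_on UNIV"
    and B: "\<And>z. \<bar>Im z\<bar> \<le> \<bar>t\<bar> \<Longrightarrow> cmod (F z) \<le> B"
  shows "(\<integral>x. iexp (t * x) * F (of_real x) \<partial>std_normal_distribution) =
         complex_of_real (exp (- t\<^sup>2 / 2)) * (\<integral>x. F (Complex x t) \<partial>std_normal_distribution)"
proof -
  have Fc: "continuous_on UNIV F" by (rule holomorphic_on_imp_continuous_on[OF F])
  have line: "(\<lambda>x. F (Complex x s)) \<in> borel_measurable borel" for s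
    by (intro borel_measurable_continuous_onI continuous_on_compose2[OF Fc] continuous_intros) auto
  have line0: "(\<lambda>x. F (of_real x)) \<in> borel_measurable borel"
    using line[of 0] by (simp add: complex_of_real_def)
  define k where "k z = exp (- (z - \<i> * of_real t)\<^sup>2 / 2) * F z" for z
  \<comment> \<open>The factor \<open>exp (t\<^sup>2 / 2)\<close> is the largest growth of the
    Gaussian weight between the two lines; \<open>sqrt (2 * pi)\<close> undoes the normalisation of
    the density.\<close>
  define b where "b x = (sqrt (2 * pi) * exp (t\<^sup>2 / 2) * B) * std_normal_density x" for x
  have shift: "(\<integral>x. k (of_real x) \<partial>lborel) = (\<integral>x. k (Complex x t) \<partial>lborel)"
  proof (rule integral_horizontal_shift)
    show "k holomorphic_on UNIV"
      unfolding k_def using F by (intro holomorphic_intros) auto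
    show "integrable lborel b" unfolding b_def by (intro integrable_mult_right) simp
    show "(b \<longlongrightarrow> 0) at_top" "(b \<longlongrightarrow> 0) at_bot"
      unfolding b_def std_normal_density_def by real_asymp+
    fix z assume z: "Im z \<in> closed_segment 0 t"
    then have "\<bar>Im z\<bar> \<le> \<bar>t\<bar>" and d: "\<bar>Im z - t\<bar> \<le> \<bar>t\<bar>"
      by (auto simp: closed_segment_eq_real_ivl split: if_splits)
    then have FB: "cmod (F z) \<le> B" by (intro B)
    have "(Im z - t)\<^sup>2 \<le> t\<^sup>2" using d by (simp add: abs_le_square_iff)
    moreover have "Re (- (z - \<i> * of_real t)\<^sup>2 / 2) = (Im z - t)\<^sup>2 / 2 - (Re z)\<^sup>2 / 2"
      by (simp add: power2_eq_square) (simp add: field_simps)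
    ultimately have "cmod (exp (- (z - \<i> * of_real t)\<^sup>2 / 2)) \<le> exp (t\<^sup>2 / 2 + - (Re z)\<^sup>2 / 2)"
      unfolding norm_exp_eq_Re by simp
    also have "\<dots> = exp (t\<^sup>2 / 2) * (sqrt (2 * pi) * std_normal_density (Re z))"
      by (simp only: exp_add) (simp add: std_normal_density_def)
    finally have "cmod (k z) \<le> exp (t\<^sup>2 / 2) * (sqrt (2 * pi) * std_normal_density (Re z)) * B"
      unfolding k_def norm_mult by (rule mult_mono[OF _ FB]) (auto simp: normal_density_nonneg)
    then show "cmod (k z) \<le> b (Re z)" by (simp add: b_def mult_ac)
  qed
  define C where "C = complex_of_real (1 / sqrt (2 * pi))"
  have expR: "complex_of_real (exp (- y\<^sup>2 / 2)) = exp (- (of_real y)\<^sup>2 / 2)" for y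
    by (subst exp_of_real[symmetric]) simp
  have nd: "complex_of_real (std_normal_density x) = C * exp (- (of_real x)\<^sup>2 / 2)" for x
    unfolding std_normal_density_def C_def of_real_mult expR ..
  have "(\<integral>x. iexp (t * x) * F (of_real x) \<partial>std_normal_distribution)
      = (\<integral>x. std_normal_density x *\<^sub>R (iexp (t * x) * F (of_real x)) \<partial>lborel)"
    using line0 by (intro integral_density) (auto simp: normal_density_nonneg)
  also have "\<dots> = (\<integral>x. (C * exp (- t\<^sup>2 / 2)) * k (of_real x) \<partial>lborel)"
  proof (rule Bochner_Integration.integral_cong)
    fix x
    have "- (of_real x)\<^sup>2 / 2 + \<i> * of_real (t * x)
        = - (of_real t)\<^sup>2 / 2 + - (of_real x - \<i> * of_real t :: complex)\<^sup>2 / 2"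
      by (simp add: power2_eq_square field_simps)
    then have "exp (- (of_real x)\<^sup>2 / 2) * iexp (t * x)
        = exp (- (of_real t)\<^sup>2 / 2) * exp (- (of_real x - \<i> * of_real t :: complex)\<^sup>2 / 2)"
      by (metis exp_add)
    then have "C * (exp (- (of_real x)\<^sup>2 / 2) * iexp (t * x)) * F (of_real x)
        = C * (exp (- t\<^sup>2 / 2) * exp (- (of_real x - \<i> * of_real t :: complex)\<^sup>2 / 2)) * F (of_real x)"
      by (simp only: expR)
    then show "std_normal_density x *\<^sub>R (iexp (t * x) * F (of_real x))
        = (C * exp (- t\<^sup>2 / 2)) * k (of_real x)"
      unfolding scaleR_conv_of_real nd k_def by (simp only: mult.assoc)
  qed simp
  also have "\<dots> = complex_of_real (exp (- t\<^sup>2 / 2)) * (C * (\<integral>x. k (Complex x t) \<partial>lborel))"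
    by (simp add: shift)
  also have "C * (\<integral>x. k (Complex x t) \<partial>lborel) = (\<integral>x. C * k (Complex x t) \<partial>lborel)"
    by simp
  also have "\<dots> = (\<integral>x. std_normal_density x *\<^sub>R F (Complex x t) \<partial>lborel)"
  proof (rule Bochner_Integration.integral_cong)
    fix x
    \<comment> \<open>On the shifted line the square is again that of a real number, so the weight
      is the standard Gaussian density.\<close>
    have "Complex x t - \<i> * of_real t = of_real x" by (simp add: complex_eq_iff)
    then show "C * k (Complex x t) = std_normal_density x *\<^sub>R F (Complex x t)"
      by (simp add: scaleR_conv_of_real nd k_def)
  qed simp
  also have "\<dots> = (\<integral>x. F (Complex x t) \<partial>std_normal_distribution)"
    using line by (intro integral_density[symmetric]) (auto simp: normal_density_nonneg)
  finally show ?thesis .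
qed

section \<open>The tilted law and Gaussian averages\<close>

text \<open>The defining identity covers only bounded real test functions. Tested on indicators, it
  identifies the law as the image of an explicit density, which opens the way to the identity
  function and to complex exponentials.\<close>

lemma distr_tilted_gaussian:
  assumes law: "has_tilted_gaussian_law M X \<gamma> \<Phi>"
    and \<Phi>: "\<And>x. \<Phi> x = of_real (g x)" and g0: "\<And>x. 0 \<le> g x"
    and gm [measurable]: "g \<in> borel_measurable borel" and gb: "\<And>x. g x \<le> B"
    and c: "c = (\<integral>x. g (x / \<gamma>) \<partial>std_normal_distribution)" "0 < c"
  shows "distr M borel X =
    distr (density std_normal_distribution (\<lambda>x. ennreal (g (x / \<gamma>) / c))) borel ((*) \<gamma>)"
    (is "_ = distr ?D _ _")
proof (rule measure_eqI)
  interpret M: prob_space M using law by (simp add: has_tilted_gaussian_law_def)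
  have X [measurable]: "X \<in> borel_measurable M"
    using law by (simp add: has_tilted_gaussian_law_def)
  interpret N: prob_space std_normal_distribution
    by (rule prob_space_normal_density) simp
  fix A assume "A \<in> sets (distr M borel X)"
  then have A [measurable]: "A \<in> sets borel" by simp
  let ?f = "indicator A :: real \<Rightarrow> real"
  have vA: "(*) \<gamma> -` A \<in> sets borel"
    using measurable_sets_borel[of "(*) \<gamma>" borel A] by simp
  have fb: "bounded (range ?f)" by (auto simp: bounded_iff indicator_def)
  have gi: "integrable std_normal_distribution (\<lambda>x. ?f (\<gamma> * x) * g (x / \<gamma>))"
    by (rule N.integrable_const_bound[of _ B])
       (auto simp: indicator_def g0 gb intro: order_trans[OF g0 gb])
  have "complex_of_real (\<integral>\<omega>. ?f (X \<omega>) \<partial>M) =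
      (\<integral>x. complex_of_real (?f (\<gamma> * x)) * \<Phi> (x / \<gamma>) \<partial>std_normal_distribution) /
          (\<integral>x. \<Phi> (x / \<gamma>) \<partial>std_normal_distribution)"
    using law fb unfolding has_tilted_gaussian_law_def by simp
  also have "\<dots> = complex_of_real ((\<integral>x. ?f (\<gamma> * x) * g (x / \<gamma>) \<partial>std_normal_distribution) / c)"
    by (simp add: \<Phi> c flip: of_real_mult)
  finally have eq: "(\<integral>\<omega>. ?f (X \<omega>) \<partial>M)
      = (\<integral>x. ?f (\<gamma> * x) * g (x / \<gamma>) / c \<partial>std_normal_distribution)"
    by (simp only: of_real_eq_iff integral_divide_zero)
  have "emeasure (distr M borel X) A = ennreal (\<integral>\<omega>. ?f (X \<omega>) \<partial>M)"
  proof -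
    have "(\<integral>\<omega>. ?f (X \<omega>) \<partial>M) = (\<integral>\<omega>. indicator (X -` A \<inter> space M) \<omega> \<partial>M)"
      by (rule Bochner_Integration.integral_cong) (auto simp: indicator_def)
    then show ?thesis by (simp add: emeasure_distr M.emeasure_eq_measure)
  qed
  also have "\<dots> = (\<integral>\<^sup>+x. ennreal (?f (\<gamma> * x) * g (x / \<gamma>) / c) \<partial>std_normal_distribution)"
    unfolding eq using gi g0 c(2) by (intro nn_integral_eq_integral[symmetric]) auto
  also have "\<dots> = emeasure ?D ((*) \<gamma> -` A)"
    using vA by (subst emeasure_density) (auto intro!: nn_integral_cong simp: indicator_def)
  also have "\<dots> = emeasure (distr ?D borel ((*) \<gamma>)) A"
    by (simp add: emeasure_distr)
  finally show "emeasure (distr M borel X) A = emeasure (distr ?D borel ((*) \<gamma>)) A" .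
qed simp

text \<open>Reflection at the origin preserves the density and turns the integral into its own
  negative. This serves to show that \<open>H n\<close> is centred.\<close>

lemma integral_std_normal_odd:
  fixes f :: "real \<Rightarrow> real"
  assumes f: "f \<in> borel_measurable borel" and odd: "\<And>x. f (- x) = - f x"
  shows "(\<integral>x. f x \<partial>std_normal_distribution) = 0"
proof -
  have eq: "(\<integral>x. f x \<partial>std_normal_distribution) = (\<integral>x. std_normal_density x * f x \<partial>lborel)"
    using f by (subst integral_density) (auto simp: normal_density_nonneg)
  have "(\<integral>x. std_normal_density x * f x \<partial>lborel)
      = (\<integral>x. std_normal_density (- x) * f (- x) \<partial>lborel)"
    using lborel_integral_real_affine[of "-1" "\<lambda>x. std_normal_density x * f x" 0] by simp
  also have "\<dots> = - (\<integral>x. std_normal_density x * f x \<partial>lborel)"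
    by (simp add: odd std_normal_density_def)
  finally show ?thesis by (simp add: eq)
qed

text \<open>Replacing \<open>f (x / s)\<close> by \<open>f 0\<close> costs at most
  \<open>L * \<bar>x\<bar> / s\<close> pointwise, and the weight does not enlarge this. The weight 1
  serves the mod-Gaussian limit, the weight \<open>iexp (t * x)\<close> the central limit
  statement.\<close>

lemma gaussian_average_estimate:
  fixes f w :: "real \<Rightarrow> complex"
  assumes f [measurable]: "f \<in> borel_measurable borel"
    and L: "\<And>x. cmod (f x - f 0) \<le> L * \<bar>x\<bar>"
    and w [measurable]: "w \<in> borel_measurable borel" and w1: "\<And>x. cmod (w x) \<le> 1"
    and "0 < s"
  shows "cmod ((\<integral>x. w x * f (x / s) \<partial>std_normal_distribution) -
            (\<integral>x. w x \<partial>std_normal_distribution) * f 0)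
         \<le> L * (\<integral>x. \<bar>x\<bar> \<partial>std_normal_distribution) / s"
proof -
  interpret N: prob_space std_normal_distribution
    by (rule prob_space_normal_density) simp
  have wi: "integrable std_normal_distribution w"
    by (rule N.integrable_const_bound[of _ 1]) (use w1 in auto)
  have ai: "integrable std_normal_distribution (\<lambda>x. L * \<bar>x\<bar> / s)"
    using integrable_std_normal_distribution_moment[of 1] by simp
  have le: "cmod (w x * (f (x / s) - f 0)) \<le> L * \<bar>x\<bar> / s" for x
  proof -
    have "cmod (w x * (f (x / s) - f 0)) \<le> 1 * (L * \<bar>x / s\<bar>)"
      unfolding norm_mult by (intro mult_mono w1 L) auto
    then show ?thesis using \<open>0 < s\<close> by simp
  qed
  have di: "integrable std_normal_distribution (\<lambda>x. w x * (f (x / s) - f 0))"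
    by (rule Bochner_Integration.integrable_bound[OF ai])
       (use order_trans[OF le abs_ge_self] in simp_all)
  have "(\<integral>x. w x * f (x / s) \<partial>std_normal_distribution)
      = (\<integral>x. w x * (f (x / s) - f 0) + w x * f 0 \<partial>std_normal_distribution)"
    by (simp add: algebra_simps)
  also have "\<dots> = (\<integral>x. w x * (f (x / s) - f 0) \<partial>std_normal_distribution)
      + (\<integral>x. w x \<partial>std_normal_distribution) * f 0"
    using wi di by simp
  finally have "cmod ((\<integral>x. w x * f (x / s) \<partial>std_normal_distribution) -
            (\<integral>x. w x \<partial>std_normal_distribution) * f 0)
      = cmod (\<integral>x. w x * (f (x / s) - f 0) \<partial>std_normal_distribution)"
    by simp
  also have "\<dots> \<le> (\<integral>x. L * \<bar>x\<bar> / s \<partial>std_normal_distribution)"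
    by (rule Bochner_Integration.integral_norm_bound_integral[OF di ai le])
  finally show ?thesis by simp
qed

theorem theorem2p4:
  fixes \<gamma> :: "nat \<Rightarrow> real"
    and \<Phi> :: "real \<Rightarrow> complex"
    and \<Phi>\<^sub>e :: "complex \<Rightarrow> complex"
    and M :: "nat \<Rightarrow> 'a measure"
    and H :: "nat \<Rightarrow> 'a \<Rightarrow> real"
  assumes "\<And>n. 0 < \<gamma> n"
    and "filterlim \<gamma> at_top sequentially"
    and "continuous_on UNIV \<Phi>"
    and "\<Phi> 0 = 1"
    and "\<And>u. cnj (\<Phi> u) = \<Phi> (- u)"
    and "\<Phi>\<^sub>e analytic_on UNIV"
    and "\<And>x. \<Phi>\<^sub>e (complex_of_real x) = \<Phi> x"
    and "\<And>\<beta> a. bdd_above ((\<lambda>z. cmod (\<Phi>\<^sub>e z)) ` vertical_segment a \<beta>)"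
    and "\<And>\<beta>. ((\<lambda>a. SUP z\<in>vertical_segment a \<beta>. cmod (\<Phi>\<^sub>e z)) \<longlongrightarrow> 0) at_top"
    and "\<And>\<beta>. ((\<lambda>a. SUP z\<in>vertical_segment a \<beta>. cmod (\<Phi>\<^sub>e z)) \<longlongrightarrow> 0) at_bot"
    and "\<And>x. \<Phi>\<^sub>e (\<i> * complex_of_real x) = \<Phi> x"
    and "\<And>x. \<Phi> x \<in> \<real>\<^sub>\<ge>\<^sub>0"
    and "\<And>n. has_tilted_gaussian_law (M n) (H n) (\<gamma> n) \<Phi>"
  shows "weak_conv_m (\<lambda>n. distr (M n) borel (\<lambda>\<omega>. H n \<omega> / \<gamma> n)) std_normal_distribution \<and>
         mod_gaussian_converges M H \<gamma> \<Phi>"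
proof -
  let ?N = "std_normal_distribution"
  interpret N: prob_space ?N by (rule prob_space_normal_density) simp
  note pos = assms(1) and law = assms(13)
  have hol: "\<Phi>\<^sub>e holomorphic_on UNIV" using assms(6) by (rule analytic_imp_holomorphic)
  have cont: "continuous_on UNIV \<Phi>\<^sub>e" by (rule holomorphic_on_imp_continuous_on[OF hol])
  have bound: "\<exists>B>0. \<forall>z. \<bar>Im z\<bar> \<le> K \<longrightarrow> cmod (\<Phi>\<^sub>e z) \<le> B" for K
    using strip_bounded[OF cont assms(8-10), of K] by metis
  have line [measurable]: "(\<lambda>x. \<Phi>\<^sub>e (Complex x u)) \<in> borel_measurable borel" for u
    by (intro borel_measurable_continuous_onI continuous_on_compose2[OF cont] continuous_intros) auto
  have line0: "\<Phi>\<^sub>e (Complex x 0) = \<Phi> x" for x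
    using assms(7)[of x] by (simp add: complex_of_real_def)
  have line1: "\<Phi>\<^sub>e (Complex 0 u) = \<Phi> u" for u
  proof -
    have "\<i> * complex_of_real u = Complex 0 u" by (simp add: complex_eq_iff)
    then show ?thesis using assms(11)[of u] by simp
  qed

  \<comment> \<open>The real density of the tilted law\<close>
  define g where "g x = Re (\<Phi> x)" for x
  have \<Phi>g: "\<Phi> x = complex_of_real (g x)" and g0: "0 \<le> g x" for x
    using assms(12)[of x] by (auto simp: g_def complex_nonneg_Reals_iff complex_eq_iff)
  \<comment> \<open>Conjugation leaves the real part unchanged, so the symmetry of \<Phi> becomes
    evenness.\<close>
  have g_even: "g (- x) = g x" for x
    using assms(5)[of x] by (metis cnj.simps(1) g_def)
  have gcont: "continuous_on UNIV g"
    unfolding g_def by (intro continuous_intros assms(3))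
  have [measurable]: "g \<in> borel_measurable borel"
    using gcont by (rule borel_measurable_continuous_onI)
  obtain Bg where Bg: "\<And>x. \<bar>g x\<bar> \<le> Bg"
  proof -
    from bound[of 0] obtain B where "\<And>z. \<bar>Im z\<bar> \<le> 0 \<Longrightarrow> cmod (\<Phi>\<^sub>e z) \<le> B" by blast
    from this[of "complex_of_real _"] show thesis
      by (intro that[of B]) (simp add: assms(7) \<Phi>g)
  qed
  define c where "c n = (\<integral>x. g (x / \<gamma> n) \<partial>?N)" for n
  have c: "0 < c n" for n
    unfolding c_def
  proof (rule integral_tilt_pos)
    show "continuous_on UNIV (\<lambda>x. g (x / \<gamma> n))"
      using pos[of n] by (intro continuous_on_compose2[OF gcont] continuous_intros) auto
    show "bounded (range (\<lambda>x. g (x / \<gamma> n)))"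
      using Bg by (auto simp: bounded_iff)
    show "g (0 / \<gamma> n) = 1" by (simp add: g_def assms(4))
  qed (rule g0)
  define D where "D n = density ?N (\<lambda>x. ennreal (g (x / \<gamma> n) / c n))" for n
  have [measurable_cong]: "sets (D n) = sets borel" for n by (simp add: D_def)
  have H [measurable]: "H n \<in> borel_measurable (M n)" for n
    using law by (simp add: has_tilted_gaussian_law_def)
  have M: "prob_space (M n)" for n
    using law by (simp add: has_tilted_gaussian_law_def)
  have distr: "distr (M n) borel (H n) = distr (D n) borel ((*) (\<gamma> n))" for n
    unfolding D_def using Bg
    by (intro distr_tilted_gaussian[OF law \<Phi>g g0 _ _ c_def c, of Bg]) (auto simp: abs_le_iff)
  \<comment> \<open>Expectations of arbitrary measurable vector-valued functions of
    \<open>H n\<close> become Gaussian integrals; in the sequel \<open>f\<close> is the identity or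
    a complex exponential.\<close>
  have transfer: "(\<integral>\<omega>. f (H n \<omega>) \<partial>M n) = (\<integral>x. (g (x / \<gamma> n) / c n) *\<^sub>R f (\<gamma> n * x) \<partial>?N)"
    if f [measurable]: "f \<in> borel_measurable borel"
    for f :: "real \<Rightarrow> 'b::{banach, second_countable_topology}" and n
  proof -
    have "(\<integral>\<omega>. f (H n \<omega>) \<partial>M n) = (\<integral>x. f x \<partial>distr (M n) borel (H n))"
      by (simp add: integral_distr)
    also have "\<dots> = (\<integral>x. f (\<gamma> n * x) \<partial>D n)"
      unfolding distr by (rule integral_distr) measurable
    also have "\<dots> = (\<integral>x. (g (x / \<gamma> n) / c n) *\<^sub>R f (\<gamma> n * x) \<partial>?N)"
      unfolding D_def using g0 c[of n] by (intro integral_density) auto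
    finally show ?thesis .
  qed

  \<comment> \<open>Integrability and zero mean\<close>
  have H_int: "integrable (M n) (H n)" for n
  proof -
    \<comment> \<open>Since \<open>g\<close> is bounded, the first absolute moment of the Gaussian
      dominates.\<close>
    have "integrable ?N (\<lambda>x. (Bg * \<gamma> n / c n) * \<bar>x\<bar>)"
      using integrable_std_normal_distribution_moment[of 1] by simp
    then have "integrable ?N (\<lambda>x. (g (x / \<gamma> n) / c n) *\<^sub>R (\<gamma> n * x))"
    proof (rule Bochner_Integration.integrable_bound)
      have "norm ((g (x / \<gamma> n) / c n) *\<^sub>R (\<gamma> n * x)) \<le> norm ((Bg * \<gamma> n / c n) * \<bar>x\<bar>)" for x
      proof -
        have "\<bar>g (x / \<gamma> n)\<bar> * (\<gamma> n / c n * \<bar>x\<bar>) \<le> \<bar>Bg\<bar> * (\<gamma> n / c n * \<bar>x\<bar>)"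
          using Bg[of "x / \<gamma> n"] pos[of n] c[of n] by (intro mult_right_mono) auto
        then show ?thesis using pos[of n] c[of n] by (simp add: abs_mult)
      qed
      then show "AE x in ?N. norm ((g (x / \<gamma> n) / c n) *\<^sub>R (\<gamma> n * x)) \<le> norm ((Bg * \<gamma> n / c n) * \<bar>x\<bar>)"
        by simp
    qed simp
    then have "integrable (D n) (\<lambda>x. \<gamma> n * x)"
      unfolding D_def using g0 c[of n] by (subst integrable_density) auto
    then have "integrable (distr (M n) borel (H n)) (\<lambda>x. x)"
      unfolding distr by (subst integrable_distr_eq) auto
    then show ?thesis by (subst (asm) integrable_distr_eq) auto
  qed
  have H_mean: "(\<integral>\<omega>. H n \<omega> \<partial>M n) = 0" for n
  proof -
    have "(\<integral>\<omega>. H n \<omega> \<partial>M n) = (\<integral>x. (g (x / \<gamma> n) / c n) *\<^sub>R (\<gamma> n * x) \<partial>?N)"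
      using transfer[of "\<lambda>x. x" n] by simp
    also have "\<dots> = 0"
      by (rule integral_std_normal_odd) (simp_all add: g_even flip: minus_divide_left)
    finally show ?thesis .
  qed

  \<comment> \<open>Uniform convergence of the shifted means\<close>
  define m where "m = (\<integral>x. \<bar>x\<bar> \<partial>?N)"
  have small: "(\<lambda>n. L * m / \<gamma> n) \<longlonglongrightarrow> 0" for L
    by (rule real_tendsto_divide_at_top[OF tendsto_const assms(2)])
  define I where "I n u = (\<integral>x. \<Phi>\<^sub>e (Complex (x / \<gamma> n) u) \<partial>?N)" for n u
  have lip: "\<exists>L. \<forall>x u. \<bar>u\<bar> \<le> K \<longrightarrow> cmod (\<Phi>\<^sub>e (Complex x u) - \<Phi>\<^sub>e (Complex 0 u)) \<le> L * \<bar>x\<bar>" for K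
  proof -
    \<comment> \<open>The extra 1 leaves room for the discs in Cauchy's inequality. The resulting
      constant depends on \<open>K\<close> alone, which makes the limit uniform in
      \<open>u\<close>.\<close>
    from bound[of "K + 1"] obtain B where B: "\<And>z. \<bar>Im z\<bar> \<le> K + 1 \<Longrightarrow> cmod (\<Phi>\<^sub>e z) \<le> B"
      by blast
    have "cmod (\<Phi>\<^sub>e (Complex x u) - \<Phi>\<^sub>e (Complex 0 u)) \<le> B * \<bar>x\<bar>" if "\<bar>u\<bar> \<le> K" for x u
      using lipschitz_on_strip[OF hol B, where K = K and z = "Complex x u" and w = "Complex 0 u"] that
      by (simp add: complex_diff complex_norm)
    then show ?thesis by blast
  qed
  have I_lim: "uniform_limit {u. \<bar>u\<bar> \<le> K} I \<Phi> sequentially" for K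
  proof (rule uniform_limitI)
    fix e :: real assume "0 < e"
    from lip[of K] obtain L where
      L: "\<And>x u. \<bar>u\<bar> \<le> K \<Longrightarrow> cmod (\<Phi>\<^sub>e (Complex x u) - \<Phi>\<^sub>e (Complex 0 u)) \<le> L * \<bar>x\<bar>"
      by blast
    have "cmod (I n u - \<Phi> u) \<le> L * m / \<gamma> n" if "\<bar>u\<bar> \<le> K" for n u
      using gaussian_average_estimate[of "\<lambda>x. \<Phi>\<^sub>e (Complex x u)" L "\<lambda>_. 1" "\<gamma> n"] L[OF that] pos[of n]
      by (simp add: I_def m_def line1 N.prob_space[simplified])
    moreover have "\<forall>\<^sub>F n in sequentially. L * m / \<gamma> n < e"
      using small \<open>0 < e\<close> by (rule order_tendstoD)
    ultimately show "\<forall>\<^sub>F n in sequentially. \<forall>u\<in>{u. \<bar>u\<bar> \<le> K}. dist (I n u) (\<Phi> u) < e"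
      by (auto simp: dist_norm elim!: eventually_mono intro: le_less_trans)
  qed
  have I0: "I n 0 = complex_of_real (c n)" for n
    by (simp add: I_def c_def line0 \<Phi>g)
  have c_lim: "(\<lambda>n. complex_of_real (c n)) \<longlonglongrightarrow> 1"
    using tendsto_uniform_limitI[OF I_lim[of 0], of 0] by (simp add: I0 assms(4))

  \<comment> \<open>Mod-Gaussian convergence\<close>
  have ratio: "(\<integral>\<omega>. iexp (u * H n \<omega>) \<partial>M n) / (\<integral>x. iexp (u * \<gamma> n * x) \<partial>?N) = I n u / c n" for u n
  proof -
    from bound[of "\<bar>u\<bar>"] obtain B where B: "\<And>z. \<bar>Im z\<bar> \<le> \<bar>u\<bar> \<Longrightarrow> cmod (\<Phi>\<^sub>e z) \<le> B" by blast
    have "(\<integral>\<omega>. iexp (u * H n \<omega>) \<partial>M n)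
        = (\<integral>x. (g (x / \<gamma> n) / c n) *\<^sub>R iexp (u * (\<gamma> n * x)) \<partial>?N)"
      by (rule transfer[of "\<lambda>x. iexp (u * x)" n]) measurable
    also have "\<dots> = (\<integral>x. iexp ((u * \<gamma> n) * x) * \<Phi>\<^sub>e (complex_of_real x / complex_of_real (\<gamma> n)) / c n \<partial>?N)"
    proof (rule Bochner_Integration.integral_cong)
      fix x
      have "\<Phi>\<^sub>e (complex_of_real x / complex_of_real (\<gamma> n)) = g (x / \<gamma> n)"
        using assms(7)[of "x / \<gamma> n"] by (simp add: \<Phi>g)
      then show "(g (x / \<gamma> n) / c n) *\<^sub>R iexp (u * (\<gamma> n * x))
          = iexp ((u * \<gamma> n) * x) * \<Phi>\<^sub>e (complex_of_real x / complex_of_real (\<gamma> n)) / c n"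
        by (simp add: scaleR_conv_of_real mult.assoc)
    qed simp
    also have "\<dots> = (\<integral>x. iexp ((u * \<gamma> n) * x) * \<Phi>\<^sub>e (complex_of_real x / complex_of_real (\<gamma> n)) \<partial>?N) / c n"
      by (rule integral_divide_zero)
    \<comment> \<open>The shift is applied to the rescaled function
      \<open>\<Phi>\<^sub>e (z / \<gamma> n)\<close> with \<open>t = u * \<gamma> n\<close>.
      Division by \<open>\<gamma> n\<close> brings the new line back to imaginary part
      \<open>u\<close>, so a bound on the strip of half-width \<open>\<bar>u\<bar>\<close> is
      enough.\<close>
    also have "(\<integral>x. iexp ((u * \<gamma> n) * x) * \<Phi>\<^sub>e (complex_of_real x / complex_of_real (\<gamma> n)) \<partial>?N)
        = complex_of_real (exp (- (u * \<gamma> n)\<^sup>2 / 2)) * (\<integral>x. \<Phi>\<^sub>e (Complex x (u * \<gamma> n) / complex_of_real (\<gamma> n)) \<partial>?N)"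
    proof (rule gaussian_contour_shift)
      show "(\<lambda>z. \<Phi>\<^sub>e (z / \<gamma> n)) holomorphic_on UNIV"
        using pos[of n] by (intro holomorphic_on_compose_gen[OF _ hol, unfolded o_def] holomorphic_intros) auto
      fix z :: complex assume "\<bar>Im z\<bar> \<le> \<bar>u * \<gamma> n\<bar>"
      then show "cmod (\<Phi>\<^sub>e (z / \<gamma> n)) \<le> B"
        using pos[of n] by (intro B) (simp add: abs_mult field_simps)
    qed
    also have "(\<lambda>x. \<Phi>\<^sub>e (Complex x (u * \<gamma> n) / complex_of_real (\<gamma> n))) = (\<lambda>x. \<Phi>\<^sub>e (Complex (x / \<gamma> n) u))"
      using pos[of n] by (intro ext arg_cong[of _ _ \<Phi>\<^sub>e]) (simp add: complex_eq_iff)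
    finally have "(\<integral>\<omega>. iexp (u * H n \<omega>) \<partial>M n) = complex_of_real (exp (- (u * \<gamma> n)\<^sup>2 / 2)) * I n u / c n"
      by (simp add: I_def)
    \<comment> \<open>This is exactly the factor extracted by the shift, so it cancels in the
      quotient.\<close>
    moreover have "(\<integral>x. iexp (u * \<gamma> n * x) \<partial>?N) = complex_of_real (exp (- (u * \<gamma> n)\<^sup>2 / 2))"
      using fun_cong[OF char_std_normal_distribution, of "u * \<gamma> n"]
      by (simp add: char_def)
    ultimately show ?thesis by simp
  qed
  have "\<exists>U. open U \<and> u\<^sub>0 \<in> U \<and> uniform_limit U (\<lambda>n u. I n u / c n) \<Phi> sequentially" for u\<^sub>0
  proof (intro exI conjI)
    let ?U = "ball u\<^sub>0 1" and ?K = "{u. \<bar>u\<bar> \<le> \<bar>u\<^sub>0\<bar> + 1}"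
    have UK: "?U \<subseteq> ?K" by (auto simp: dist_real_def)
    have inv: "(\<lambda>n. 1 / complex_of_real (c n)) \<longlonglongrightarrow> 1"
      using tendsto_divide[OF tendsto_const c_lim] by simp
    \<comment> \<open>The factor \<open>1 / c n\<close> does not depend on \<open>u\<close>, so its
      convergence is uniform; the product rule then asks for bounded limits, and \<Phi> is bounded
      on the real line.\<close>
    have "uniform_limit ?U (\<lambda>n u. I n u * (1 / complex_of_real (c n))) (\<lambda>u. \<Phi> u * 1) sequentially"
    proof (rule uniform_lim_mult)
      show "uniform_limit ?U I \<Phi> sequentially"
        by (rule uniform_limit_on_subset[OF I_lim UK])
      show "uniform_limit ?U (\<lambda>n u. 1 / complex_of_real (c n)) (\<lambda>u. 1) sequentially"
        unfolding uniform_limit_iff using tendstoD[OF inv] by (auto elim!: eventually_mono)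
      show "bounded (\<Phi> ` ?U)" using Bg by (auto simp: bounded_iff \<Phi>g)
      show "bounded ((\<lambda>u. 1 :: complex) ` ?U)" by (auto simp: bounded_iff)
    qed
    then show "uniform_limit ?U (\<lambda>n u. I n u / c n) \<Phi> sequentially" by simp
  qed auto
  then have mod: "mod_gaussian_converges M H \<gamma> \<Phi>"
    unfolding mod_gaussian_converges_def ratio using M H_int H_mean pos by blast

  \<comment> \<open>Convergence in law by characteristic functions\<close>
  have "weak_conv_m (\<lambda>n. distr (M n) borel (\<lambda>\<omega>. H n \<omega> / \<gamma> n)) ?N"
  proof (rule levy_continuity)
    show "real_distribution ?N" by (rule real_dist_normal_dist)
    show "real_distribution (distr (M n) borel (\<lambda>\<omega>. H n \<omega> / \<gamma> n))" for n
      using prob_space.real_distribution_distr[OF M] by measurable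
    fix t
    from lip[of 0] obtain L where
      L: "\<And>x. cmod (\<Phi>\<^sub>e (Complex x 0) - \<Phi>\<^sub>e (Complex 0 0)) \<le> L * \<bar>x\<bar>"
      by force
    \<comment> \<open>After division by \<open>\<gamma> n\<close> the frequency \<open>t\<close> is
      fixed, so the exponential is a weight of modulus 1 and the estimate applies directly on the
      real line, that is, with strip half-width 0.\<close>
    define J where "J n = (\<integral>x. iexp (t * x) * \<Phi>\<^sub>e (Complex (x / \<gamma> n) 0) \<partial>?N)" for n
    have "cmod (J n - char ?N t) \<le> L * m / \<gamma> n" for n
      using gaussian_average_estimate[of "\<lambda>x. \<Phi>\<^sub>e (Complex x 0)" L "\<lambda>x. iexp (t * x)" "\<gamma> n"] L pos[of n] line[of 0]
      by (simp add: J_def m_def line0 assms(4) char_def)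
    then have "(\<lambda>n. J n - char ?N t) \<longlonglongrightarrow> 0"
      by (intro Lim_null_comparison[OF always_eventually small[of L]]) simp
    then have "J \<longlonglongrightarrow> char ?N t"
      by (rule LIM_zero_cancel)
    from tendsto_divide[OF this c_lim] have "(\<lambda>n. J n / c n) \<longlonglongrightarrow> char ?N t" by simp
    moreover have "char (distr (M n) borel (\<lambda>\<omega>. H n \<omega> / \<gamma> n)) t = J n / c n" for n
    proof -
      have "char (distr (M n) borel (\<lambda>\<omega>. H n \<omega> / \<gamma> n)) t = (\<integral>\<omega>. iexp (t * (H n \<omega> / \<gamma> n)) \<partial>M n)"
        by (simp add: char_def integral_distr)
      also have "\<dots> = (\<integral>x. (g (x / \<gamma> n) / c n) *\<^sub>R iexp (t * (\<gamma> n * x / \<gamma> n)) \<partial>?N)"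
        by (rule transfer[of "\<lambda>x. iexp (t * (x / \<gamma> n))" n]) measurable
      also have "\<dots> = (\<integral>x. iexp (t * x) * \<Phi>\<^sub>e (Complex (x / \<gamma> n) 0) / c n \<partial>?N)"
        using pos[of n] by (intro Bochner_Integration.integral_cong)
          (simp_all add: scaleR_conv_of_real line0 \<Phi>g mult_ac)
      also have "\<dots> = J n / c n"
        unfolding J_def by (rule integral_divide_zero)
      finally show ?thesis .
    qed
    ultimately show "(\<lambda>n. char (distr (M n) borel (\<lambda>\<omega>. H n \<omega> / \<gamma> n)) t) \<longlonglongrightarrow> char ?N t"
      by simp
  qed
  with mod show ?thesis by blast
qed

end
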